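(* Let $n\ge 1$ be an integer, let $\mathcal{V}_n$ be the Baskakov operator, regarded as a linear automorphism of the space $\mathbb{P}$ of polynomials, and let $\mathcal{U}_n=\mathcal{V}_n^{-1}$ be its inverse on $\mathbb{P}$. Write $$\mathcal{V}_n=\sum_{r\ge 0}\theta_r D^r,\qquad \mathcal{U}_n=\sum_{r\ge 0}\eta_r D^r \quad\text{on } \mathbb{P},$$ with polynomial coefficients $\theta_r=\theta_r^{(n)}$ and $\eta_r=\eta_r^{(n)}$. Put $X=x(1+x)$. Then $\theta_0=1$, $\theta_1=0$, $\eta_0=1$, $\eta_1=0$, and for all $r\ge 1$ $$n(r+1)\,\theta_{r+1}(x)=X\bigl(D\theta_r(x)+\theta_{r-1}(x)\bigr),$$ $$(n+r)(r+1)\,\eta_{r+1}(x)=-r(1+2x)\,\eta_r(x)-X\,\eta_{r-1}(x).$$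
   Context: $D=d/dx$, and $\mathbb{P}$ is the space of real polynomials in one variable. For an integer $n\ge1$ the Baskakov operator is $$\mathcal{V}_nf(x)=\sum_{k\ge 0} f\left(\tfrac kn\right) v_{k,n}(x),\qquad v_{k,n}(x)=\binom{n+k-1}{k}x^k(1+x)^{-(n+k)},\quad x\ge 0.$$ For a polynomial $f$ the series converges for every $x\ge0$ and its sum is (the restriction to $[0,\infty)$ of) a polynomial of the same degree as $f$; thus $\mathcal{V}_n$ is a degree-preserving linear isomorphism of $\mathbb{P}$. Explicitly, $\mathcal{V}_n$ maps $\prod_{i=0}^{r-1}(x-\frac in)$ to $\frac{n(n+1)\cdots(n+r-1)}{n^r}x^r$. Every linear operator on $\mathbb{P}$ can be written uniquely as $\sum_{r\ge0}a_r(x)D^r$ with polynomial coefficients $a_r$ (the sum is finite when applied to any given polynomial); $\theta_r^{(n)}$ and $\eta_r^{(n)}$ are these coefficients for $\mathcal{V}_n$ and $\mathcal{U}_n=\mathcal{V}_n^{-1}$ respectively. *)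

theory Defs
  imports "HOL-Analysis.Analysis" "HOL-Computational_Algebra.Polynomial"
begin

definition baskakov_basis :: "nat \<Rightarrow> nat \<Rightarrow> real \<Rightarrow> real" where
  "baskakov_basis n k x = real ((n + k - 1) choose k) * x ^ k / (1 + x) ^ (n + k)"

definition baskakov :: "nat \<Rightarrow> (real \<Rightarrow> real) \<Rightarrow> real \<Rightarrow> real" where
  "baskakov n f x = (\<Sum>k. f (real k / real n) * baskakov_basis n k x)"

text \<open>
  The operator on polynomials: the unique polynomial that agrees with the series on the
  half-line.  Lemmas \<open>baskakov_poly\<close> and \<open>baskakov_sums\<close> below show that the description is
  proper and that the series converges, for \<open>n \<ge> 1\<close>.
\<close>

definition baskakov_poly :: "nat \<Rightarrow> real poly \<Rightarrow> real poly" where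
  "baskakov_poly n p = (THE q. \<forall>x\<ge>0. poly q x = baskakov n (poly p) x)"

definition baskakov_inv :: "nat \<Rightarrow> real poly \<Rightarrow> real poly" where
  "baskakov_inv n = inv (baskakov_poly n)"

text \<open>
  \<open>L = (\<Sum>r. a r * D ^ r)\<close>; the terms with \<open>r > degree p\<close> vanish on \<open>p\<close>, so the sum over
  \<open>r \<le> degree p\<close> is the full series.
\<close>

definition diffop_expansion :: "(real poly \<Rightarrow> real poly) \<Rightarrow> (nat \<Rightarrow> real poly) \<Rightarrow> bool" where
  "diffop_expansion L a \<longleftrightarrow> (\<forall>p. L p = (\<Sum>r\<le>degree p. a r * (pderiv ^^ r) p))"

definition diffop_coeff :: "(real poly \<Rightarrow> real poly) \<Rightarrow> nat \<Rightarrow> real poly" where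
  "diffop_coeff L = (THE a. diffop_expansion L a)"

definition baskakov_theta :: "nat \<Rightarrow> nat \<Rightarrow> real poly" where
  "baskakov_theta n = diffop_coeff (baskakov_poly n)"

definition baskakov_eta :: "nat \<Rightarrow> nat \<Rightarrow> real poly" where
  "baskakov_eta n = diffop_coeff (baskakov_inv n)"

lemma higher_pderiv_eq_0:
  fixes p :: "real poly"
  assumes "degree p < r"
  shows "(pderiv ^^ r) p = 0"
  using assms by (intro poly_eqI) (simp add: coeff_higher_pderiv coeff_eq_0)

lemma smult_sum2_poly: "smult c (sum f A) = (\<Sum>x\<in>A. smult (c :: real) (f x))"
  by (induction A rule: infinite_finite_induct) (auto simp: smult_add_right)

lemma higher_pderiv_monom_self: "(pderiv ^^ m) (monom 1 m :: real poly) = [:fact m:]"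
  by (intro poly_eqI)
     (auto simp: coeff_higher_pderiv coeff_pCons pochhammer_fact split: nat.split)

lemma diffop_sum_extend:
  fixes p :: "real poly"
  assumes "degree p \<le> N"
  shows "(\<Sum>r\<le>degree p. a r * (pderiv ^^ r) p) = (\<Sum>r\<le>N. a r * (pderiv ^^ r) p)"
  using assms by (intro sum.mono_neutral_left) (auto simp: higher_pderiv_eq_0)

lemma diffop_expansion_unique:
  assumes "diffop_expansion L a" "diffop_expansion L b"
  shows "a = b"
proof
  fix m
  show "a m = b m"
  proof (induction m rule: less_induct)
    case (less m)
    have *: "L (monom 1 m) = (\<Sum>r<m. c r * (pderiv ^^ r) (monom 1 m)) + smult (fact m) (c m)"
      if "diffop_expansion L c" for c
    proof -
      have "L (monom 1 m) = (\<Sum>r\<le>m. c r * (pderiv ^^ r) (monom 1 m))"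
        using that unfolding diffop_expansion_def by (simp add: degree_monom_eq)
      then show ?thesis
        by (simp add: lessThan_Suc_atMost [symmetric] higher_pderiv_monom_self)
    qed
    have "(\<Sum>r<m. a r * (pderiv ^^ r) (monom 1 m)) = (\<Sum>r<m. b r * (pderiv ^^ r) (monom 1 m))"
      by (intro sum.cong) (auto simp: less)
    with *[OF assms(1)] *[OF assms(2)] have "smult (fact m) (a m) = smult (fact m) (b m)"
      by simp
    then show ?case
      using smult_cancel[of "fact m :: real"] by auto
  qed
qed

lemma diffop_expansion_exists:
  assumes add: "\<And>p q. L (p + q) = L p + L q" and smult: "\<And>c p. L (smult c p) = smult c (L p)"
  shows "\<exists>a. diffop_expansion L a"
proof -
  have "\<exists>a. \<forall>m. a m = smult (1 / fact m)
          (L (monom 1 m) - (\<Sum>r<m. a r * (pderiv ^^ r) (monom 1 m)))"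
  proof (rule dependent_wf_choice[OF wf_less])
    fix f g :: "nat \<Rightarrow> real poly" and x r
    assume "\<And>z. (z, x) \<in> {(x, y). x < y} \<Longrightarrow> f z = g z"
    then have "(\<Sum>i<x. f i * (pderiv ^^ i) (monom 1 x)) = (\<Sum>i<x. g i * (pderiv ^^ i) (monom 1 x))"
      by (intro sum.cong) auto
    then show "(r = smult (1 / fact x) (L (monom 1 x) - (\<Sum>i<x. f i * (pderiv ^^ i) (monom 1 x))))
        = (r = smult (1 / fact x) (L (monom 1 x) - (\<Sum>i<x. g i * (pderiv ^^ i) (monom 1 x))))"
      by simp
  qed auto
  then obtain a where a: "\<And>m. a m = smult (1 / fact m)
          (L (monom 1 m) - (\<Sum>r<m. a r * (pderiv ^^ r) (monom 1 m)))"
    by blast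
  have monom: "L (monom 1 m) = (\<Sum>r\<le>m. a r * (pderiv ^^ r) (monom 1 m))" for m
  proof -
    have "smult (fact m) (a m) = L (monom 1 m) - (\<Sum>r<m. a r * (pderiv ^^ r) (monom 1 m))"
      by (subst a) simp
    then show ?thesis
      by (simp add: lessThan_Suc_atMost [symmetric] higher_pderiv_monom_self)
  qed
  have L0: "L 0 = 0"
    using smult[of 0 0] by simp
  have Lsum: "L (\<Sum>i\<in>A. f i) = (\<Sum>i\<in>A. L (f i))" if "finite A" for f :: "nat \<Rightarrow> real poly" and A
    using that by induction (auto simp: L0 add)
  have "L p = (\<Sum>r\<le>degree p. a r * (pderiv ^^ r) p)" for p
  proof -
    have "L p = L (\<Sum>i\<le>degree p. smult (coeff p i) (monom 1 i))"
      by (simp add: smult_monom poly_as_sum_of_monoms)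
    also have "\<dots> = (\<Sum>i\<le>degree p. smult (coeff p i) (L (monom 1 i)))"
      by (simp add: Lsum smult)
    also have "\<dots> = (\<Sum>i\<le>degree p. smult (coeff p i)
                      (\<Sum>r\<le>degree p. a r * (pderiv ^^ r) (monom 1 i)))"
      using diffop_sum_extend[of "monom 1 _" "degree p" a]
      by (intro sum.cong) (auto simp: monom degree_monom_eq)
    also have "\<dots> = (\<Sum>r\<le>degree p. \<Sum>i\<le>degree p. a r * (pderiv ^^ r) (smult (coeff p i) (monom 1 i)))"
      by (subst sum.swap) (simp add: smult_sum2_poly higher_pderiv_smult)
    also have "\<dots> = (\<Sum>r\<le>degree p. a r * (pderiv ^^ r) (\<Sum>i\<le>degree p. smult (coeff p i) (monom 1 i)))"
      by (simp only: higher_pderiv_sum sum_distrib_left)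
    also have "\<dots> = (\<Sum>r\<le>degree p. a r * (pderiv ^^ r) p)"
      by (simp add: smult_monom poly_as_sum_of_monoms)
    finally show ?thesis .
  qed
  then show ?thesis
    unfolding diffop_expansion_def by blast
qed

lemma diffop_expansion_coeff:
  assumes "\<And>p q. L (p + q) = L p + L q" "\<And>c p. L (smult c p) = smult c (L p)"
  shows "diffop_expansion L (diffop_coeff L)"
proof -
  obtain a where "diffop_expansion L a"
    using diffop_expansion_exists assms by blast
  then show ?thesis
    unfolding diffop_coeff_def
    by (rule theI[where P = "diffop_expansion L"]) (blast intro: diffop_expansion_unique \<open>diffop_expansion L a\<close>)
qed

lemma baskakov_basis_sums:
  assumes "n \<ge> 1" "x \<ge> 0"
  shows "(\<lambda>k. baskakov_basis n k x) sums 1"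
proof -
  define z where "z = x / (1 + x)"
  have z: "\<bar>- z\<bar> < 1" "1 + - z = 1 / (1 + x)"
    using assms by (auto simp: z_def field_simps)
  have "(\<lambda>k. (- real n gchoose k) * (- z) ^ k) sums (1 + - z) powr (- real n)"
    by (rule gen_binomial_real[OF z(1)])
  also have "(1 + - z) powr (- real n) = (1 + x) ^ n"
    unfolding z(2) using assms by (simp add: powr_minus powr_divide powr_realpow)
  finally have "(\<lambda>k. (- real n gchoose k) * (- z) ^ k / (1 + x) ^ n) sums ((1 + x) ^ n / (1 + x) ^ n)"
    by (rule sums_divide)
  moreover have "(- real n gchoose k) * (- z) ^ k / (1 + x) ^ n = baskakov_basis n k x" for k
  proof -
    have "(- real n gchoose k) = (- 1) ^ k * real ((n + k - 1) choose k)"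
      using assms by (simp add: gbinomial_minus binomial_gbinomial of_nat_diff)
    moreover have "(- 1) ^ k * (- z) ^ k = z ^ k"
      by (simp flip: power_mult_distrib)
    ultimately have "(- real n gchoose k) * (- z) ^ k = real ((n + k - 1) choose k) * z ^ k"
      by simp
    then show ?thesis
      using assms by (simp add: baskakov_basis_def z_def power_divide power_add)
  qed
  ultimately show ?thesis
    using assms by simp
qed

definition falling_poly :: "nat \<Rightarrow> nat \<Rightarrow> real poly" where
  "falling_poly n r = (\<Prod>i<r. [:- (real i / real n), 1:])"

lemma baskakov_falling_sums:
  assumes n: "n \<ge> 1" and x: "x \<ge> 0"
  shows "(\<lambda>k. poly (falling_poly n r) (real k / real n) * baskakov_basis n k x) sums
           (pochhammer (real n) r / real n ^ r * x ^ r)" (is "?f sums ?s")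
proof -
  have zero: "?f k = 0" if "k < r" for k
  proof -
    have "poly (falling_poly n r) (real k / real n) = 0"
      using that unfolding falling_poly_def poly_prod by (intro prod_zero) auto
    then show ?thesis by simp
  qed
  have shift: "?f (j + r) = ?s * baskakov_basis (n + r) j x" for j
  proof -
    have "poly (falling_poly n r) (real (j + r) / real n) = (\<Prod>i<r. real (j + r - i) / real n)"
      unfolding falling_poly_def poly_prod
      by (intro prod.cong) (auto simp: diff_divide_distrib of_nat_diff)
    also have "\<dots> = (\<Prod>i<r. real (j + r - i)) / real n ^ r"
      by (simp add: prod_dividef)
    also have "(\<Prod>i<r. real (j + r - i)) = fact (j + r) / fact j"
    proof (induction r)
      case (Suc r)
      have "(\<Prod>i<Suc r. real (j + Suc r - i)) = real (j + Suc r) * (\<Prod>i<r. real (j + r - i))"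
        by (subst prod.lessThan_Suc_shift) simp
      then show ?case using Suc by simp
    qed simp
    finally have fall: "poly (falling_poly n r) (real (j + r) / real n)
        = fact (j + r) / fact j / real n ^ r" .
    obtain m where m: "n = Suc m"
      using n by (cases n) auto
    have poch: "pochhammer (real n) r = fact (m + r) / fact m"
      using pochhammer_product'[of "1::real" m r] by (simp add: m flip: pochhammer_fact)
    have b1: "real ((n + (j + r) - 1) choose (j + r)) = fact (m + j + r) / (fact (j + r) * fact m)"
      by (subst binomial_fact) (auto simp: m add_ac)
    have b2: "real ((n + r + j - 1) choose j) = fact (m + j + r) / (fact j * fact (m + r))"
      by (subst binomial_fact) (auto simp: m add_ac)
    show ?thesis
      unfolding baskakov_basis_def fall poch b1 b2
      by (simp add: field_simps power_add)
  qed
  have "(\<lambda>j. ?f (j + r)) sums ?s"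
    unfolding shift using sums_mult[OF baskakov_basis_sums[of "n + r" x], of ?s] n x by simp
  then have "?f sums (?s + (\<Sum>k<r. ?f k))"
    by (rule iffD1[OF sums_iff_shift[of ?f r ?s]])
  also have "(\<Sum>k<r. ?f k) = 0"
    using zero by (intro sum.neutral) auto
  finally show ?thesis by simp
qed

lemma degree_falling_poly: "degree (falling_poly n r) = r"
  unfolding falling_poly_def by (subst degree_prod_eq_sum_degree) auto

lemma lead_coeff_falling_poly: "coeff (falling_poly n r) r = 1"
proof -
  have "lead_coeff (falling_poly n r) = 1"
    unfolding falling_poly_def by (simp add: lead_coeff_prod)
  then show ?thesis by (simp add: degree_falling_poly)
qed

lemma falling_poly_span:
  assumes "degree p \<le> d"
  shows "\<exists>c. p = (\<Sum>r\<le>d. smult (c r) (falling_poly n r))"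
  using assms
proof (induction d arbitrary: p)
  case 0
  then obtain a where "p = [:a:]" by (auto elim: degree_eq_zeroE)
  then show ?case by (intro exI[of _ "\<lambda>_. a"]) (simp add: falling_poly_def)
next
  case (Suc d)
  define q where "q = p - smult (coeff p (Suc d)) (falling_poly n (Suc d))"
  have "degree q \<le> d"
  proof (rule degree_le, safe)
    fix i assume "d < i"
    then consider "i = Suc d" | "Suc d < i" by linarith
    then show "coeff q i = 0"
    proof cases
      case 1
      then show ?thesis by (simp add: q_def lead_coeff_falling_poly)
    next
      case 2
      then show ?thesis
        using Suc.prems by (simp add: q_def coeff_eq_0 degree_falling_poly)
    qed
  qed
  then obtain c where c: "q = (\<Sum>r\<le>d. smult (c r) (falling_poly n r))"
    using Suc.IH by blast
  have "p = q + smult (coeff p (Suc d)) (falling_poly n (Suc d))"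
    by (simp add: q_def)
  also have "\<dots> = (\<Sum>r\<le>Suc d. smult ((c(Suc d := coeff p (Suc d))) r) (falling_poly n r))"
    by (simp add: c)
  finally show ?case by blast
qed

lemma falling_combination_sums:
  assumes "n \<ge> 1" "x \<ge> 0" and p: "p = (\<Sum>r\<le>d. smult (c r) (falling_poly n r))"
  shows "(\<lambda>k. poly p (real k / real n) * baskakov_basis n k x) sums
           poly (\<Sum>r\<le>d. monom (c r * (pochhammer (real n) r / real n ^ r)) r) x"
proof -
  have "(\<lambda>k. \<Sum>r\<le>d. c r * (poly (falling_poly n r) (real k / real n) * baskakov_basis n k x)) sums
          (\<Sum>r\<le>d. c r * (pochhammer (real n) r / real n ^ r * x ^ r))"
    by (intro sums_sum sums_mult baskakov_falling_sums assms)
  then show ?thesis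
    by (simp add: p poly_sum poly_monom sum_distrib_right mult.assoc)
qed

lemma poly_eq_nonneg:
  fixes p q :: "real poly"
  assumes "\<And>x. x \<ge> 0 \<Longrightarrow> poly p x = poly q x"
  shows "p = q"
proof -
  have "{0..} \<subseteq> {x. poly (p - q) x = 0}"
    using assms by auto
  then have "infinite {x. poly (p - q) x = 0}"
    using infinite_Ici finite_subset by blast
  then have "p - q = 0"
    using poly_roots_finite by blast
  then show ?thesis by simp
qed

lemma baskakov_poly_eqI:
  assumes "\<And>x. x \<ge> 0 \<Longrightarrow> poly q x = baskakov n (poly p) x"
  shows "baskakov_poly n p = q"
  unfolding baskakov_poly_def
  by (rule the_equality) (auto simp: assms intro: poly_eq_nonneg)

lemma baskakov_poly_falling_combination:
  assumes "n \<ge> 1" "p = (\<Sum>r\<le>d. smult (c r) (falling_poly n r))"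
  shows "baskakov_poly n p = (\<Sum>r\<le>d. monom (c r * (pochhammer (real n) r / real n ^ r)) r)"
  using falling_combination_sums[OF assms(1) _ assms(2)]
  by (intro baskakov_poly_eqI) (simp add: baskakov_def sums_unique)

lemma baskakov_sums:
  assumes "n \<ge> 1" "x \<ge> 0"
  shows "(\<lambda>k. poly p (real k / real n) * baskakov_basis n k x) sums poly (baskakov_poly n p) x"
proof -
  obtain c where c: "p = (\<Sum>r\<le>degree p. smult (c r) (falling_poly n r))"
    using falling_poly_span by blast
  show ?thesis
    using falling_combination_sums[OF assms c]
    unfolding baskakov_poly_falling_combination[OF assms(1) c] .
qed

lemma baskakov_poly:
  assumes "n \<ge> 1" "x \<ge> 0"
  shows "poly (baskakov_poly n p) x = baskakov n (poly p) x"
  using baskakov_sums[OF assms] by (simp add: baskakov_def sums_unique)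

lemma baskakov_poly_add:
  assumes "n \<ge> 1"
  shows "baskakov_poly n (p + q) = baskakov_poly n p + baskakov_poly n q"
proof (rule poly_eq_nonneg)
  fix x :: real assume x: "x \<ge> 0"
  show "poly (baskakov_poly n (p + q)) x = poly (baskakov_poly n p + baskakov_poly n q) x"
    using sums_add[OF baskakov_sums[OF assms x] baskakov_sums[OF assms x]]
      sums_unique2[OF baskakov_sums[OF assms x, of "p + q"]]
    by (simp add: distrib_right)
qed

lemma baskakov_poly_smult:
  assumes "n \<ge> 1"
  shows "baskakov_poly n (smult c p) = smult c (baskakov_poly n p)"
proof (rule poly_eq_nonneg)
  fix x :: real assume x: "x \<ge> 0"
  show "poly (baskakov_poly n (smult c p)) x = poly (smult c (baskakov_poly n p)) x"
    using sums_mult[OF baskakov_sums[OF assms x], of c]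
      sums_unique2[OF baskakov_sums[OF assms x, of "smult c p"]]
    by (simp add: mult.assoc)
qed

lemma bij_baskakov_poly:
  assumes n: "n \<ge> 1"
  shows "bij (baskakov_poly n)"
proof -
  define w where "w r = pochhammer (real n) r / real n ^ r" for r
  have w: "w r \<noteq> 0" for r
    using n pochhammer_pos[of "real n" r] by (auto simp: w_def)
  have kernel: "p = 0" if "baskakov_poly n p = 0" for p
  proof -
    obtain c where c: "p = (\<Sum>r\<le>degree p. smult (c r) (falling_poly n r))"
      using falling_poly_span by blast
    have "(\<Sum>r\<le>degree p. monom (c r * w r) r) = 0"
      using baskakov_poly_falling_combination[OF n c] that by (simp add: w_def)
    moreover have "coeff (\<Sum>r\<le>degree p. monom (c r * w r) r) i = c i * w i" if "i \<le> degree p" for i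
      using that by (simp add: coeff_sum)
    ultimately have "c i = 0" if "i \<le> degree p" for i
      using that w by (metis coeff_0 mult_eq_0_iff)
    then show ?thesis
      using c by simp
  qed
  have "inj (baskakov_poly n)"
  proof (rule injI)
    fix p q assume eq: "baskakov_poly n p = baskakov_poly n q"
    have "baskakov_poly n (p + smult (- 1) q) = 0"
      unfolding baskakov_poly_add[OF n] baskakov_poly_smult[OF n] by (simp add: eq)
    from kernel[OF this] show "p = q" by simp
  qed
  moreover have "\<exists>p. q = baskakov_poly n p" for q
  proof -
    have "baskakov_poly n (\<Sum>r\<le>degree q. smult (coeff q r / w r) (falling_poly n r))
        = (\<Sum>r\<le>degree q. monom (coeff q r / w r * w r) r)"
      unfolding w_def by (rule baskakov_poly_falling_combination[OF n refl])
    also have "\<dots> = q"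
      using w by (simp add: poly_as_sum_of_monoms)
    finally show ?thesis by metis
  qed
  ultimately show ?thesis
    unfolding bij_def surj_def by blast
qed

lemma baskakov_theta_expansion:
  assumes "n \<ge> 1"
  shows "diffop_expansion (baskakov_poly n) (baskakov_theta n)"
  unfolding baskakov_theta_def
  by (intro diffop_expansion_coeff baskakov_poly_add baskakov_poly_smult assms)

lemma baskakov_eta_expansion:
  assumes n: "n \<ge> 1"
  shows "diffop_expansion (baskakov_inv n) (baskakov_eta n)"
proof -
  have inj: "inj (baskakov_poly n)" and surj: "surj (baskakov_poly n)"
    using bij_baskakov_poly[OF n] by (auto simp: bij_def)
  have inv: "baskakov_poly n (baskakov_inv n p) = p" for p
    unfolding baskakov_inv_def by (rule surj_f_inv_f[OF surj])
  show ?thesis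
    unfolding baskakov_eta_def
  proof (rule diffop_expansion_coeff)
    show "baskakov_inv n (p + q) = baskakov_inv n p + baskakov_inv n q" for p q
      by (rule injD[OF inj]) (simp only: baskakov_poly_add[OF n] inv)
    show "baskakov_inv n (smult c p) = smult c (baskakov_inv n p)" for c p
      by (rule injD[OF inj]) (simp only: baskakov_poly_smult[OF n] inv)
  qed
qed

end

(*
  Write x for multiplication by the variable. On the basis of shifted factorials one checks
  n (V x - x V) = X D V; multiplying by U on both sides gives n (x U - U x) = U X D. Passing
  from L to L x replaces the coefficients a_r of L by x a_r + (r + 1) a_(r+1), and comparing
  the coefficients of D^r in the two operator identities gives the two recursions.
*)
theory Submission
  imports Defs
begin

section \<open>Coefficients of differential operators\<close>

lemma diffop_expansionD:
  assumes "diffop_expansion L a" "degree p \<le> N"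
  shows "L p = (\<Sum>r\<le>N. a r * (pderiv ^^ r) p)"
  using assms(1) diffop_sum_extend[OF assms(2), of a] unfolding diffop_expansion_def by simp

text \<open>Composition with D moves coefficients up by one index, so sums arise with one term
  beyond the degree; that term vanishes on \<open>p\<close>.\<close>

lemma diffop_expansionI:
  assumes "\<And>p. L p = (\<Sum>r\<le>Suc (degree p). a r * (pderiv ^^ r) p)"
  shows "diffop_expansion L a"
  unfolding diffop_expansion_def
proof
  fix p :: "real poly"
  show "L p = (\<Sum>r\<le>degree p. a r * (pderiv ^^ r) p)"
    unfolding assms by (rule diffop_sum_extend[symmetric]) simp
qed

lemma diffop_expansion_add:
  assumes "diffop_expansion L a" "diffop_expansion M b"
  shows "diffop_expansion (\<lambda>p. L p + M p) (\<lambda>r. a r + b r)"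
  using assms unfolding diffop_expansion_def by (simp add: sum.distrib distrib_right)

lemma diffop_expansion_mult_left:
  assumes "diffop_expansion L a"
  shows "diffop_expansion (\<lambda>p. q * L p) (\<lambda>r. q * a r)"
  using assms unfolding diffop_expansion_def by (simp add: sum_distrib_left mult.assoc)

text \<open>Leibniz rule: only two terms survive because the second derivative of x is 0. With
  \<open>Suc r\<close> no power D^(r-1) has to be interpreted at r = 0.\<close>

lemma higher_pderiv_mult_x:
  fixes p :: "real poly"
  shows "(pderiv ^^ Suc r) ([:0, 1:] * p)
    = [:0, 1:] * (pderiv ^^ Suc r) p + smult (real (Suc r)) ((pderiv ^^ r) p)"
proof (induction r)
  case 0
  show ?case by (simp add: pderiv_pCons)
next
  case (Suc r)
  have "(pderiv ^^ Suc (Suc r)) ([:0, 1:] * p) = pderiv ((pderiv ^^ Suc r) ([:0, 1:] * p))"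
    by simp
  also have "\<dots> = [:0, 1:] * (pderiv ^^ Suc (Suc r)) p
      + smult (real (Suc (Suc r))) ((pderiv ^^ Suc r) p)"
    unfolding Suc.IH by (rule poly_ext) (simp add: pderiv_add pderiv_smult pderiv_pCons algebra_simps)
  finally show ?case .
qed

text \<open>Since D^r x = x D^r + r D^(r-1), the coefficient of D^r collects x a_r from the same
  index and (r+1) a_(r+1) from the next one.\<close>

lemma diffop_expansion_mult_x_right:
  assumes L: "diffop_expansion L a"
  shows "diffop_expansion (\<lambda>p. L ([:0, 1:] * p))
           (\<lambda>r. [:0, 1:] * a r + smult (real (Suc r)) (a (Suc r)))"
proof -
  have "L ([:0, 1:] * p) = (\<Sum>r\<le>degree p.
      ([:0, 1:] * a r + smult (real (Suc r)) (a (Suc r))) * (pderiv ^^ r) p)" for p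
  proof -
    let ?x = "[:0, 1:] :: real poly" and ?d = "degree p"
    have "degree (?x * p) \<le> Suc ?d"
      by (simp add: degree_pCons_le)
    then have "L (?x * p) = (\<Sum>r\<le>Suc ?d. a r * (pderiv ^^ r) (?x * p))"
      by (rule diffop_expansionD[OF L])
    \<comment> \<open>The term r = 0 produces no derivative of x and is split off; it is merged back
      once the Leibniz rule has been applied to the others.\<close>
    also have "\<dots> = a 0 * (?x * p) + (\<Sum>r\<le>?d. a (Suc r) * (pderiv ^^ Suc r) (?x * p))"
      by (subst sum.atMost_Suc_shift) simp
    also have "\<dots> = (?x * (a 0 * p) + (\<Sum>r\<le>?d. ?x * (a (Suc r) * (pderiv ^^ Suc r) p)))
        + (\<Sum>r\<le>?d. smult (real (Suc r)) (a (Suc r)) * (pderiv ^^ r) p)"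
      unfolding higher_pderiv_mult_x
      by (simp only: distrib_left sum.distrib mult_smult_left mult_smult_right add.assoc
          mult.left_commute[of _ ?x])
    also have "?x * (a 0 * p) + (\<Sum>r\<le>?d. ?x * (a (Suc r) * (pderiv ^^ Suc r) p))
        = (\<Sum>r\<le>Suc ?d. ?x * (a r * (pderiv ^^ r) p))"
      by (subst sum.atMost_Suc_shift) simp
    also have "\<dots> = (\<Sum>r\<le>?d. ?x * (a r * (pderiv ^^ r) p))"
      by (simp add: higher_pderiv_eq_0 del: funpow.simps)
    finally show ?thesis
      by (simp add: sum.distrib distrib_right mult.assoc)
  qed
  then show ?thesis
    unfolding diffop_expansion_def by blast
qed

text \<open>\<open>case_nat 0 a\<close> is the sequence a_(r-1) with a_(-1) = 0, the shift caused by
  D^r D = D^(r+1).\<close>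

lemma diffop_expansion_pderiv_right:
  assumes L: "diffop_expansion L a"
  shows "diffop_expansion (\<lambda>p. L (pderiv p)) (case_nat 0 a)"
proof (rule diffop_expansionI)
  fix p :: "real poly"
  have "L (pderiv p) = (\<Sum>r\<le>degree p. a r * (pderiv ^^ r) (pderiv p))"
    by (rule diffop_expansionD[OF L]) (simp add: degree_pderiv)
  also have "\<dots> = (\<Sum>r\<le>Suc (degree p). case_nat 0 a r * (pderiv ^^ r) p)"
    by (subst sum.atMost_Suc_shift) (simp add: funpow_swap1)
  finally show "L (pderiv p) = \<dots>" .
qed

lemma pderiv_sum_poly: "pderiv (\<Sum>r\<in>A. f r) = (\<Sum>r\<in>A. pderiv (f r :: real poly))"
  using higher_pderiv_sum[of 1 f A] by simp

text \<open>The product rule as an operator identity: D a_r = a_r' + a_r D.\<close>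

lemma diffop_expansion_pderiv_left:
  assumes L: "diffop_expansion L a"
  shows "diffop_expansion (\<lambda>p. pderiv (L p)) (\<lambda>r. pderiv (a r) + case_nat 0 a r)"
proof (rule diffop_expansionI)
  fix p :: "real poly"
  let ?d = "degree p"
  \<comment> \<open>The extra zero term gives both halves the same final range: the half with the
    raised power of D loses its top term and regains the length when reindexed.\<close>
  have "pderiv (L p) = pderiv (\<Sum>r\<le>Suc ?d. a r * (pderiv ^^ r) p)"
    by (subst diffop_expansionD[OF L, of p "Suc ?d"]) simp_all
  also have "\<dots> = (\<Sum>r\<le>Suc ?d. pderiv (a r) * (pderiv ^^ r) p)
      + (\<Sum>r\<le>Suc ?d. a r * (pderiv ^^ Suc r) p)"
    unfolding pderiv_sum_poly by (simp add: pderiv_mult sum.distrib algebra_simps)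
  also have "(\<Sum>r\<le>Suc ?d. a r * (pderiv ^^ Suc r) p) = (\<Sum>r\<le>?d. a r * (pderiv ^^ Suc r) p)"
    by (simp add: higher_pderiv_eq_0 del: funpow.simps)
  also have "\<dots> = (\<Sum>r\<le>Suc ?d. case_nat 0 a r * (pderiv ^^ r) p)"
    by (subst sum.atMost_Suc_shift) simp
  finally show "pderiv (L p)
      = (\<Sum>r\<le>Suc ?d. (pderiv (a r) + case_nat 0 a r) * (pderiv ^^ r) p)"
    by (simp only: sum.distrib distrib_right)
qed

lemma diffop_expansion_0:
  assumes "diffop_expansion L a"
  shows "a 0 = L 1"
  using diffop_expansionD[OF assms, of 1 0] by simp

section \<open>The commutation relations of the Baskakov operator\<close>

lemma baskakov_poly_falling:
  assumes "n \<ge> 1"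
  shows "baskakov_poly n (falling_poly n r) = monom (pochhammer (real n) r / real n ^ r) r"
  using baskakov_falling_sums[OF assms]
  by (intro baskakov_poly_eqI) (simp add: baskakov_def sums_unique poly_monom)

lemma baskakov_poly_sum:
  assumes "n \<ge> 1"
  shows "baskakov_poly n (\<Sum>i\<in>A. f i) = (\<Sum>i\<in>A. baskakov_poly n (f i))"
proof -
  have "baskakov_poly n 0 = 0"
    using baskakov_poly_smult[OF assms, of 0 0] by simp
  then show ?thesis
    by (induction A rule: infinite_finite_induct) (auto simp: baskakov_poly_add[OF assms])
qed

lemma mult_x_falling_poly:
  "[:0, 1:] * falling_poly n r = falling_poly n (Suc r) + smult (real r / real n) (falling_poly n r)"
  by (simp add: falling_poly_def)

text \<open>Both sides are linear in \<open>p\<close>, so shifted factorials suffice. With w_r the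
  factor of x^r in the image of the r-th one, n w_(r+1) = (n+r) w_r, and both sides become w_r
  ((n+r) x^(r+1) + r x^r).\<close>

lemma baskakov_poly_mult_x:
  assumes n: "n \<ge> 1"
  shows "smult (real n) (baskakov_poly n ([:0, 1:] * p))
    = smult (real n) ([:0, 1:] * baskakov_poly n p) + [:0, 1, 1:] * pderiv (baskakov_poly n p)"
proof -
  let ?V = "baskakov_poly n" and ?x = "[:0, 1:] :: real poly"
  have falling: "smult (real n) (?V (?x * falling_poly n r))
      = smult (real n) (?x * ?V (falling_poly n r)) + [:0, 1, 1:] * pderiv (?V (falling_poly n r))"
    (is "?lhs = ?rhs") for r
  proof (rule poly_ext)
    fix y :: real
    define w where "w = pochhammer (real n) r / real n ^ r"
    have w': "pochhammer (real n) (Suc r) / real n ^ Suc r = w * (real n + real r) / real n"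
      by (simp add: w_def pochhammer_Suc)
    have "poly ?lhs y = w * ((real n + real r) * y ^ Suc r + real r * y ^ r)"
      unfolding mult_x_falling_poly baskakov_poly_add[OF n] baskakov_poly_smult[OF n]
        baskakov_poly_falling[OF n] w' using n
      by (simp add: poly_monom field_simps flip: w_def)
    also have "\<dots> = poly ?rhs y"
      unfolding baskakov_poly_falling[OF n] w_def[symmetric]
      \<comment> \<open>The derivative of x^r carries the truncated exponent r - 1, hence the case r
        = 0 apart.\<close>
      by (cases r) (simp_all add: pderiv_monom poly_monom algebra_simps)
    finally show "poly ?lhs y = poly ?rhs y" .
  qed
  obtain c where c: "p = (\<Sum>r\<le>degree p. smult (c r) (falling_poly n r))"
    using falling_poly_span by blast
  have "smult (real n) (?V (?x * p))
      = (\<Sum>r\<le>degree p. smult (c r) (smult (real n) (?V (?x * falling_poly n r))))"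
    by (subst c, unfold sum_distrib_left mult_smult_right baskakov_poly_sum[OF n]
        baskakov_poly_smult[OF n] smult_sum2_poly) (simp add: mult.commute)
  also have "\<dots> = smult (real n) (?x * (\<Sum>r\<le>degree p. smult (c r) (?V (falling_poly n r))))
      + [:0, 1, 1:] * pderiv (\<Sum>r\<le>degree p. smult (c r) (?V (falling_poly n r)))"
    unfolding falling pderiv_sum_poly sum_distrib_left smult_sum2_poly sum.distrib[symmetric]
      mult_smult_right pderiv_smult smult_add_right
    by (simp add: mult.commute)
  also have "(\<Sum>r\<le>degree p. smult (c r) (?V (falling_poly n r))) = ?V p"
    \<comment> \<open>Only the \<open>p\<close> under \<open>?V\<close> is expanded; the one in
      \<open>degree p\<close> has to stay.\<close>
    by (subst (2) c) (simp only: baskakov_poly_sum[OF n] baskakov_poly_smult[OF n])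
  finally show ?thesis .
qed

lemma baskakov_poly_inv:
  assumes "n \<ge> 1"
  shows "baskakov_poly n (baskakov_inv n p) = p" "baskakov_inv n (baskakov_poly n p) = p"
  using bij_baskakov_poly[OF assms]
  by (auto simp: baskakov_inv_def bij_def surj_f_inv_f)

text \<open>Under the injective V both sides become n x p + X D p, the left one by the commutation
  relation of V at \<open>baskakov_inv n p\<close>.\<close>

lemma baskakov_inv_mult_x:
  assumes n: "n \<ge> 1"
  shows "smult (real n) ([:0, 1:] * baskakov_inv n p)
    = smult (real n) (baskakov_inv n ([:0, 1:] * p)) + baskakov_inv n ([:0, 1, 1:] * pderiv p)"
    (is "?lhs = ?rhs")
proof -
  have "baskakov_poly n ?lhs = baskakov_poly n ?rhs"
    by (simp only: baskakov_poly_add[OF n] baskakov_poly_smult[OF n] baskakov_poly_inv(1)[OF n]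
        baskakov_poly_mult_x[OF n])
  then show ?thesis
    using bij_baskakov_poly[OF n] by (auto simp: bij_def dest: injD)
qed

lemma baskakov_poly_1:
  assumes "n \<ge> 1"
  shows "baskakov_poly n 1 = 1" "baskakov_inv n 1 = 1"
proof -
  show V: "baskakov_poly n 1 = 1"
    using baskakov_poly_falling[OF assms, of 0] by (simp add: falling_poly_def monom_0 one_pCons)
  show "baskakov_inv n 1 = 1"
    using baskakov_poly_inv(2)[OF assms, of 1] by (simp add: V)
qed

section \<open>The recursions\<close>

text \<open>Two expansions of the operator n V x are compared; n x theta_r occurs in both and
  cancels. The form with \<open>case_nat\<close> includes r = 0, which yields theta_1.\<close>

lemma baskakov_theta_recursion:
  assumes n: "n \<ge> 1"
  shows "smult (real n * real (Suc r)) (baskakov_theta n (Suc r))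
    = [:0, 1, 1:] * (pderiv (baskakov_theta n r) + case_nat 0 (baskakov_theta n) r)"
proof -
  \<comment> \<open>As a constant polynomial, n is covered by the rule for left
    multiplication.\<close>
  let ?a = "baskakov_theta n" and ?x = "[:0, 1:] :: real poly" and ?n = "[:real n:]"
  note V = baskakov_theta_expansion[OF n]
  have "diffop_expansion (\<lambda>p. ?n * baskakov_poly n (?x * p))
      (\<lambda>r. ?n * (?x * ?a r + smult (real (Suc r)) (?a (Suc r))))"
    by (intro diffop_expansion_mult_left diffop_expansion_mult_x_right V)
  moreover have "(\<lambda>p. ?n * baskakov_poly n (?x * p))
      = (\<lambda>p. ?n * (?x * baskakov_poly n p) + [:0, 1, 1:] * pderiv (baskakov_poly n p))"
    using baskakov_poly_mult_x[OF n] by simp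
  moreover have "diffop_expansion \<dots>
      (\<lambda>r. ?n * (?x * ?a r) + [:0, 1, 1:] * (pderiv (?a r) + case_nat 0 ?a r))"
    by (intro diffop_expansion_add diffop_expansion_mult_left diffop_expansion_pderiv_left V)
  ultimately have "?n * (?x * ?a r + smult (real (Suc r)) (?a (Suc r)))
      = ?n * (?x * ?a r) + [:0, 1, 1:] * (pderiv (?a r) + case_nat 0 ?a r)"
    using diffop_expansion_unique by (metis (no_types, lifting))
  then have "?n * smult (real (Suc r)) (?a (Suc r))
      = [:0, 1, 1:] * (pderiv (?a r) + case_nat 0 ?a r)"
    by (simp only: distrib_left[of ?n] add_left_cancel)
  moreover have "?n * smult (real (Suc r)) (?a (Suc r))
      = smult (real n * real (Suc r)) (?a (Suc r))"
    by (simp add: mult.commute)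
  ultimately show ?thesis
    by (simp only:)
qed

text \<open>Because X = x + x^2, right multiplication by X reduces to that by x, used once and
  twice: \<open>b\<close> and \<open>c\<close> are the coefficients of U x and U x^2. The operator U
  X D then has the coefficients b_(r-1) + c_(r-1).\<close>

lemma baskakov_eta_recursion:
  assumes n: "n \<ge> 1"
  shows "smult ((real n + real r) * real (Suc r)) (baskakov_eta n (Suc r))
    = - smult (real r) ([:1, 2:] * baskakov_eta n r)
      - [:0, 1, 1:] * case_nat 0 (baskakov_eta n) r"
proof -
  let ?a = "baskakov_eta n" and ?x = "[:0, 1:] :: real poly" and ?n = "[:real n:]"
  note U = baskakov_eta_expansion[OF n]
  define b where "b = (\<lambda>r. ?x * ?a r + smult (real (Suc r)) (?a (Suc r)))"
  define c where "c = (\<lambda>r. ?x * b r + smult (real (Suc r)) (b (Suc r)))"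
  have b: "diffop_expansion (\<lambda>p. baskakov_inv n (?x * p)) b"
    unfolding b_def by (rule diffop_expansion_mult_x_right[OF U])
  have c: "diffop_expansion (\<lambda>p. baskakov_inv n (?x * (?x * p))) c"
    unfolding c_def by (rule diffop_expansion_mult_x_right[OF b])
  have split: "baskakov_inv n ([:0, 1, 1:] * q)
      = baskakov_inv n (?x * q) + baskakov_inv n (?x * (?x * q))" for q
  proof -
    \<comment> \<open>The inverse of an additive bijection is additive.\<close>
    have "baskakov_inv n (p + q) = baskakov_inv n p + baskakov_inv n q" for p q
      by (metis baskakov_poly_add baskakov_poly_inv n)
    moreover have "[:0, 1, 1:] * q = ?x * q + ?x * (?x * q)"
      by simp
    ultimately show ?thesis by (simp only:)
  qed
  have "diffop_expansion (\<lambda>p. baskakov_inv n (?x * p) + baskakov_inv n (?x * (?x * p)))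
      (\<lambda>r. b r + c r)"
    by (rule diffop_expansion_add[OF b c])
  from diffop_expansion_add[OF diffop_expansion_mult_left[OF b, of ?n]
      diffop_expansion_pderiv_right[OF this]]
  have "diffop_expansion
      (\<lambda>p. ?n * baskakov_inv n (?x * p) + baskakov_inv n ([:0, 1, 1:] * pderiv p))
      (\<lambda>r. ?n * b r + case_nat 0 (\<lambda>r. b r + c r) r)"
    by (simp only: split)
  moreover have "(\<lambda>p. ?n * (?x * baskakov_inv n p))
      = (\<lambda>p. ?n * baskakov_inv n (?x * p) + baskakov_inv n ([:0, 1, 1:] * pderiv p))"
    using baskakov_inv_mult_x[OF n] by simp
  moreover have "diffop_expansion (\<lambda>p. ?n * (?x * baskakov_inv n p)) (\<lambda>r. ?n * (?x * ?a r))"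
    by (intro diffop_expansion_mult_left U)
  ultimately have "?n * (?x * ?a r) = ?n * b r + case_nat 0 (\<lambda>r. b r + c r) r"
    using diffop_expansion_unique by (metis (no_types, lifting))
  \<comment> \<open>The term n x eta_r on the left cancels against the first half of n b_r.\<close>
  then have *: "smult (real n * real (Suc r)) (?a (Suc r)) + case_nat 0 (\<lambda>r. b r + c r) r = 0"
    by (simp add: b_def smult_add_right)
  show ?thesis
  proof (cases r)
    case 0
    with * show ?thesis by simp
  next
    case (Suc s)
    \<comment> \<open>Unfolded, b_(r-1) + c_(r-1) is X eta_(r-1) + r (1+2x) eta_r + r (r+1)
      eta_(r+1); its last term turns the factor n into n + r.\<close>
    show ?thesis
    proof (rule poly_ext)
      fix y :: real
      have "poly (smult (real n * real (Suc r)) (?a (Suc r))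
          + case_nat 0 (\<lambda>r. b r + c r) r) y = 0"
        by (simp only: * poly_0)
      then show "poly (smult ((real n + real r) * real (Suc r)) (?a (Suc r))) y
          = poly (- smult (real r) ([:1, 2:] * ?a r) - [:0, 1, 1:] * case_nat 0 ?a r) y"
        unfolding Suc by (simp add: b_def c_def algebra_simps)
    qed
  qed
qed

theorem theorem1:
  fixes n :: nat and X :: "real poly"
  assumes "n \<ge> 1" and "X = [:0, 1:] * (1 + [:0, 1:])"
  shows "baskakov_theta n 0 = 1 \<and> baskakov_theta n 1 = 0 \<and>
    baskakov_eta n 0 = 1 \<and> baskakov_eta n 1 = 0 \<and>
    (\<forall>r\<ge>1.
      smult (real n * (real r + 1)) (baskakov_theta n (r + 1)) =
        X * (pderiv (baskakov_theta n r) + baskakov_theta n (r - 1)) \<and>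
      smult ((real n + real r) * (real r + 1)) (baskakov_eta n (r + 1)) =
        - smult (real r) ([:1, 2:] * baskakov_eta n r) - X * baskakov_eta n (r - 1))"
proof (intro conjI allI impI)
  have X: "X = [:0, 1, 1:]"
    using assms(2) by (simp add: one_pCons)
  show theta0: "baskakov_theta n 0 = 1" and eta0: "baskakov_eta n 0 = 1"
    using diffop_expansion_0 baskakov_theta_expansion baskakov_eta_expansion baskakov_poly_1
      assms(1) by metis+
  \<comment> \<open>At r = 0 the recursions have right-hand side 0: theta_0 = 1 has derivative 0,
    the factor r of eta_0 is 0, and the shifted sequences start with 0.\<close>
  show "baskakov_theta n 1 = 0"
    using baskakov_theta_recursion[OF assms(1), of 0] assms(1) by (simp add: theta0)
  show "baskakov_eta n 1 = 0"
    using baskakov_eta_recursion[OF assms(1), of 0] assms(1) by simp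
  fix r :: nat assume r: "r \<ge> 1"
  then have prev: "case_nat 0 a r = a (r - 1)" for a :: "nat \<Rightarrow> real poly"
    by (cases r) auto
  have suc: "real (r + 1) = real r + 1"
    by simp
  show "smult (real n * (real r + 1)) (baskakov_theta n (r + 1)) =
      X * (pderiv (baskakov_theta n r) + baskakov_theta n (r - 1))"
    using baskakov_theta_recursion[OF assms(1), of r] by (simp only: prev X suc Suc_eq_plus1)
  show "smult ((real n + real r) * (real r + 1)) (baskakov_eta n (r + 1)) =
      - smult (real r) ([:1, 2:] * baskakov_eta n r) - X * baskakov_eta n (r - 1)"
    using baskakov_eta_recursion[OF assms(1), of r] by (simp only: prev X suc Suc_eq_plus1)
qed

end
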